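(* Assume that the risk-sensitive constrained problem $$\sup_{\Pi\in\Gamma} J_r(\Pi,\alpha_r)\quad\text{subject to}\quad J_c(\Pi,\alpha_c)\le B$$ has a solution. For every policy $\Pi\in\Gamma$ let $\mathcal M(\Pi)\subseteq\Gamma$ be the solution set (set of maximizers) of the linear program $$\mathrm{LP}(\Pi):\quad \max_{\tilde\Pi\in\Gamma}\ \sum_{t=1}^{T-1} f_t(\tilde\Pi,\Theta^{\Pi}_r,\mathbb Q^{\Pi}_r)\quad\text{subject to}\quad f_t(\tilde\Pi,\Theta^{\Pi}_c,\mathbb Q^{\Pi}_c)\le B\ \text{ for all } 1\le t<T .$$ Then any optimal policy $\Pi^*$ of the risk-sensitive constrained problem satisfies the fixed-point equation $\Pi^*\in\mathcal M(\Pi^* )$.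
   Context: Setting. $T<\infty$ is the horizon ($T\ge 2$). For $1\le t\le T$, $\mathcal S_t$ is a finite nonempty state space; for $1\le t\le T-1$ and $x\in\mathcal S_t$, $\mathcal A_{t,x}$ is a finite nonempty action set; $p_t(x'|x,a)$ is the probability of moving to $x'\in\mathcal S_{t+1}$ from $x\in\mathcal S_t$ under action $a\in\mathcal A_{t,x}$. A (Markovian randomized) policy is $\Pi=(d_1,\dots,d_{T-1})$, where for each $t$ and $x\in\mathcal S_t$, $d_t(x,\cdot)$ is a probability distribution on $\mathcal A_{t,x}$; $\Gamma$ is the set of all such policies. Given real functions $\tilde r_t(x,a,x')$, $\tilde c_t(x,a,x')$ ($t\le T-1$) and $\tilde r_T(x)$, $\tilde c_T(x)$, risk factors $\gamma,\gamma_c\in\mathbb R$ and discount factors $\beta,\beta_c\in(0,1)$, set $r_t=\gamma\beta^t\tilde r_t$ and $c_t=\gamma_c\beta_c^t\tilde c_t$ for $1\le t\le T$. $\alpha_r,\alpha_c$ are probability distributions on $\mathcal S_1$ and $B\in\mathbb R$. For $m\in\{r,c\}$, $$J_m(\Pi,\alpha_m)=E^{\Pi}_{\alpha_m}\Big[e^{\sum_{t=1}^{T-1} m_t(X_t,A_t,X_{t+1})+m_T(X_T)}\Big],$$ where $(X_t,A_t)$ is the state-action process under $\Pi$ with $X_1\sim\alpha_m$. Forward factors: for $1\le t\le T$, $x\in\mathcal S_t$, $$\theta^{\Pi}_{m,t}(x)=E^{\Pi}_{\alpha_m}\Big[e^{\sum_{k=1}^{t-1}m_k(X_k,A_k,X_{k+1})}\mathbf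 1_{\{X_t=x\}}\Big].$$ Backward factors: for $1\le t\le T-1$, $x\in\mathcal S_t$, $a\in\mathcal A_{t,x}$, $$Q^{\Pi}_{m,t}(x,a)=E^{\Pi}\Big[e^{\sum_{\tau=t}^{T-1}m_\tau(X_\tau,A_\tau,X_{\tau+1})+m_T(X_T)}\,\Big|\,X_t=x,A_t=a\Big],$$ computed for the process started at time $t$ in state $x$ with action $a$ and with $\Pi$ used from time $t+1$ onwards. Write $\Theta^{\Pi}_m=(\theta^{\Pi}_{m,t}(x))_{t,x}$ and $\mathbb Q^{\Pi}_m=(Q^{\Pi}_{m,t}(x,a))_{t,x,a}$. For policies $\Pi$ and $\tilde\Pi=(\tilde d_1,\dots,\tilde d_{T-1})$ and $t\le T-1$, $$f_t(\tilde\Pi,\Theta^{\Pi}_m,\mathbb Q^{\Pi}_m)=\sum_{x\in\mathcal S_t}\sum_{a\in\mathcal A_{t,x}}\theta^{\Pi}_{m,t}(x)\,\tilde d_t(x,a)\,Q^{\Pi}_{m,t}(x,a).$$ *)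

theory Defs
  imports "HOL-Probability.Probability"
begin

text \<open>
  All state and action spaces are carved out of two ambient types; \<open>states M t\<close> is relevant for
  \<open>1 \<le> t \<le> horizon M\<close>, \<open>actions M t x\<close> and \<open>kernel M t x a\<close> for \<open>1 \<le> t < horizon M\<close>, \<open>x \<in> states M t\<close>
  and \<open>a \<in> actions M t x\<close>.
\<close>

record ('s, 'a) mdp =
  horizon :: nat
  states :: "nat \<Rightarrow> 's set"
  actions :: "nat \<Rightarrow> 's \<Rightarrow> 'a set"
  kernel :: "nat \<Rightarrow> 's \<Rightarrow> 'a \<Rightarrow> 's pmf"

locale finite_mdp =
  fixes M :: "('s, 'a) mdp"
  assumes horizon_ge_2: "2 \<le> horizon M"
    and states_finite: "\<And>t. t \<in> {1..horizon M} \<Longrightarrow> finite (states M t)"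
    and states_nonempty: "\<And>t. t \<in> {1..horizon M} \<Longrightarrow> states M t \<noteq> {}"
    and actions_finite:
      "\<And>t x. t \<in> {1..<horizon M} \<Longrightarrow> x \<in> states M t \<Longrightarrow> finite (actions M t x)"
    and actions_nonempty:
      "\<And>t x. t \<in> {1..<horizon M} \<Longrightarrow> x \<in> states M t \<Longrightarrow> actions M t x \<noteq> {}"
    and kernel_states:
      "\<And>t x a. t \<in> {1..<horizon M} \<Longrightarrow> x \<in> states M t \<Longrightarrow> a \<in> actions M t x \<Longrightarrow>
         set_pmf (kernel M t x a) \<subseteq> states M (Suc t)"

type_synonym ('s, 'a) policy = "nat \<Rightarrow> 's \<Rightarrow> 'a pmf"

definition policies :: "('s, 'a) mdp \<Rightarrow> ('s, 'a) policy set" where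
  "policies M =
     {\<pi>. \<forall>t\<in>{1..<horizon M}. \<forall>x\<in>states M t. set_pmf (\<pi> t x) \<subseteq> actions M t x}"

record ('s, 'a) payoff =
  running :: "nat \<Rightarrow> 's \<Rightarrow> 'a \<Rightarrow> 's \<Rightarrow> real"
  terminal :: "'s \<Rightarrow> real"

definition risk_discounted ::
  "('s, 'a) mdp \<Rightarrow> real \<Rightarrow> real \<Rightarrow> ('s, 'a) payoff \<Rightarrow> ('s, 'a) payoff" where
  "risk_discounted M \<gamma> \<beta> m =
     \<lparr>running = (\<lambda>t x a y. \<gamma> * \<beta> ^ t * running m t x a y),
      terminal = (\<lambda>x. \<gamma> * \<beta> ^ horizon M * terminal m x)\<rparr>"

text \<open>
  A sample path is a pair \<open>(X, A)\<close> of state and action sequences. Its coordinates are filled in as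
  the process evolves; the ones never reached keep the value \<^term>\<open>undefined\<close>.
\<close>

type_synonym ('s, 'a) path = "(nat \<Rightarrow> 's) \<times> (nat \<Rightarrow> 'a)"

definition transition ::
  "('s, 'a) mdp \<Rightarrow> nat \<Rightarrow> 'a \<Rightarrow> ('s, 'a) path \<Rightarrow> ('s, 'a) path pmf" where
  "transition M t a \<omega> =
     map_pmf (\<lambda>y. ((fst \<omega>)(Suc t := y), (snd \<omega>)(t := a))) (kernel M t (fst \<omega> t) a)"

text \<open>\<open>evolve M \<pi> n t \<omega>\<close> continues the path \<open>\<omega>\<close>, known up to \<open>X\<^sub>t\<close>, by \<open>n\<close> steps under \<open>\<pi>\<close>.\<close>

primrec evolve ::
  "('s, 'a) mdp \<Rightarrow> ('s, 'a) policy \<Rightarrow> nat \<Rightarrow> nat \<Rightarrow> ('s, 'a) path \<Rightarrow> ('s, 'a) path pmf" where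
  "evolve M \<pi> 0 t \<omega> = return_pmf \<omega>"
| "evolve M \<pi> (Suc n) t \<omega> =
     bind_pmf (\<pi> t (fst \<omega> t)) (\<lambda>a. bind_pmf (transition M t a \<omega>) (evolve M \<pi> n (Suc t)))"

definition start_at :: "nat \<Rightarrow> 's \<Rightarrow> ('s, 'a) path" where
  "start_at t x = ((\<lambda>_. undefined)(t := x), \<lambda>_. undefined)"

text \<open>Law of the state-action process with \<open>X\<^sub>1\<close> distributed according to \<open>\<alpha>\<close>.\<close>

definition process_law ::
  "('s, 'a) mdp \<Rightarrow> ('s, 'a) policy \<Rightarrow> 's pmf \<Rightarrow> ('s, 'a) path pmf" where
  "process_law M \<pi> \<alpha> = bind_pmf \<alpha> (\<lambda>x. evolve M \<pi> (horizon M - 1) 1 (start_at 1 x))"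

text \<open>
  Law of the process started at time \<open>t\<close> in state \<open>x\<close> with action \<open>a\<close>, using \<open>\<pi>\<close> from time \<open>t + 1\<close>
  on. Unlike an elementary conditional expectation, it is also meaningful when \<open>(x, a)\<close> has
  probability zero at time \<open>t\<close>.
\<close>

definition process_law_from ::
  "('s, 'a) mdp \<Rightarrow> ('s, 'a) policy \<Rightarrow> nat \<Rightarrow> 's \<Rightarrow> 'a \<Rightarrow> ('s, 'a) path pmf" where
  "process_law_from M \<pi> t x a =
     bind_pmf (transition M t a (start_at t x)) (evolve M \<pi> (horizon M - Suc t) (Suc t))"

definition J ::
  "('s, 'a) mdp \<Rightarrow> ('s, 'a) payoff \<Rightarrow> ('s, 'a) policy \<Rightarrow> 's pmf \<Rightarrow> real" where
  "J M m \<pi> \<alpha> =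
     measure_pmf.expectation (process_law M \<pi> \<alpha>)
       (\<lambda>(X, A). exp ((\<Sum>t\<in>{1..<horizon M}. running m t (X t) (A t) (X (Suc t)))
                      + terminal m (X (horizon M))))"

definition forward_factor ::
  "('s, 'a) mdp \<Rightarrow> ('s, 'a) payoff \<Rightarrow> ('s, 'a) policy \<Rightarrow> 's pmf \<Rightarrow> nat \<Rightarrow> 's \<Rightarrow> real" where
  "forward_factor M m \<pi> \<alpha> t x =
     measure_pmf.expectation (process_law M \<pi> \<alpha>)
       (\<lambda>(X, A). exp (\<Sum>k\<in>{1..<t}. running m k (X k) (A k) (X (Suc k)))
                 * indicat_real {x} (X t))"

definition backward_factor ::
  "('s, 'a) mdp \<Rightarrow> ('s, 'a) payoff \<Rightarrow> ('s, 'a) policy \<Rightarrow> nat \<Rightarrow> 's \<Rightarrow> 'a \<Rightarrow> real" where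
  "backward_factor M m \<pi> t x a =
     measure_pmf.expectation (process_law_from M \<pi> t x a)
       (\<lambda>(X, A). exp ((\<Sum>\<tau>\<in>{t..<horizon M}. running m \<tau> (X \<tau>) (A \<tau>) (X (Suc \<tau>)))
                      + terminal m (X (horizon M))))"

definition stage_value ::
  "('s, 'a) mdp \<Rightarrow> nat \<Rightarrow> ('s, 'a) policy \<Rightarrow> (nat \<Rightarrow> 's \<Rightarrow> real) \<Rightarrow>
     (nat \<Rightarrow> 's \<Rightarrow> 'a \<Rightarrow> real) \<Rightarrow> real" where
  "stage_value M t \<pi>' \<Theta> Q =
     (\<Sum>x\<in>states M t. \<Sum>a\<in>actions M t x. \<Theta> t x * pmf (\<pi>' t x) a * Q t x a)"

definition risk_constrained_solutions ::
  "('s, 'a) mdp \<Rightarrow> ('s, 'a) payoff \<Rightarrow> ('s, 'a) payoff \<Rightarrow> 's pmf \<Rightarrow> 's pmf \<Rightarrow> real \<Rightarrow>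
     ('s, 'a) policy set" where
  "risk_constrained_solutions M r c \<alpha>\<^sub>r \<alpha>\<^sub>c B =
     {\<pi>. is_arg_max (\<lambda>\<pi>'. J M r \<pi>' \<alpha>\<^sub>r) (\<lambda>\<pi>'. \<pi>' \<in> policies M \<and> J M c \<pi>' \<alpha>\<^sub>c \<le> B) \<pi>}"

definition LP_solutions ::
  "('s, 'a) mdp \<Rightarrow> ('s, 'a) payoff \<Rightarrow> ('s, 'a) payoff \<Rightarrow> 's pmf \<Rightarrow> 's pmf \<Rightarrow> real \<Rightarrow>
     ('s, 'a) policy \<Rightarrow> ('s, 'a) policy set" where
  "LP_solutions M r c \<alpha>\<^sub>r \<alpha>\<^sub>c B \<pi> =
     {\<pi>\<^sub>1. is_arg_max
        (\<lambda>\<pi>'. \<Sum>t\<in>{1..<horizon M}.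
           stage_value M t \<pi>' (forward_factor M r \<pi> \<alpha>\<^sub>r) (backward_factor M r \<pi>))
        (\<lambda>\<pi>'. \<pi>' \<in> policies M \<and>
           (\<forall>t\<in>{1..<horizon M}.
              stage_value M t \<pi>' (forward_factor M c \<pi> \<alpha>\<^sub>c) (backward_factor M c \<pi>) \<le> B))
        \<pi>\<^sub>1}"

end

theory Submission
  imports Defs
begin

text \<open>
  The LP objective and constraints are sums over single stages, and each of these stage values is
  the exponential cost of an actual policy: in
  \<open>f\<^sub>t(\<pi>', \<Theta>\<^sup>\<pi>, Q\<^sup>\<pi>) = (\<Sum>x a. \<theta>\<^sup>\<pi>\<^sub>t(x) d'\<^sub>t(x,a) Q\<^sup>\<pi>\<^sub>t(x,a))\<close> the factor \<open>\<theta>\<^sup>\<pi>\<^sub>t\<close>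
  accounts for the multiplicative weight collected before time \<open>t\<close> under \<open>\<pi>\<close>, and \<open>Q\<^sup>\<pi>\<^sub>t\<close> for the
  weight collected from then on, so the sum is the cost \<open>J\<close> of the one-stage deviation
  \<open>\<pi>(t := \<pi>' t)\<close>, which follows \<open>\<pi>'\<close> at time \<open>t\<close> and \<open>\<pi>\<close> at all other times
  (lemma \<open>stage_value_eq_J\<close>).

  Consequently an LP-feasible \<open>\<pi>'\<close> is one all of whose deviations \<open>\<pi>(t := \<pi>' t)\<close> are feasible for
  the risk-constrained problem. If \<open>\<pi>\<close> is optimal there, none of them earns more than \<open>\<pi>\<close> itself,
  and summing over \<open>t\<close> bounds the LP objective of \<open>\<pi>'\<close> by \<open>(T - 1) J(\<pi>)\<close>. Deviating from
  \<open>\<pi>\<close> to \<open>\<pi>\<close> changes nothing, so \<open>\<pi>\<close> is LP-feasible and attains this bound.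

  The identity itself is the Markov property. Cut the process law at time \<open>t\<close>
  (\<open>process_law_split\<close>): the initial piece depends on \<open>\<pi>\<close> only through the decisions before \<open>t\<close>
  (\<open>evolve_policy_cong\<close>), and the expected weight of the remaining piece is a function of the state
  \<open>X\<^sub>t\<close> alone (\<open>expectation_evolve\<close>). Splitting the expectation according to the value of \<open>X\<^sub>t\<close>
  gives the sum over states.
\<close>

section \<open>Expectations under finitely supported distributions\<close>

lemma expectation_bind_finite:
  fixes h :: "'b \<Rightarrow> real"
  assumes "finite (set_pmf p)" and "\<And>x. x \<in> set_pmf p \<Longrightarrow> finite (set_pmf (f x))"
  shows "measure_pmf.expectation (bind_pmf p f) h =
         measure_pmf.expectation p (\<lambda>x. measure_pmf.expectation (f x) h)"
proof -
  have "measure_pmf.expectation (bind_pmf p f) h =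
        (\<Sum>x\<in>set_pmf p. pmf p x *\<^sub>R measure_pmf.expectation (f x) h)"
    using assms by (intro pmf_expectation_bind) auto
  also have "\<dots> = measure_pmf.expectation p (\<lambda>x. measure_pmf.expectation (f x) h)"
    using assms by (subst integral_measure_pmf_real[of "set_pmf p"]) (auto simp: mult.commute)
  finally show ?thesis .
qed

lemma expectation_cong_support:
  fixes f g :: "'b \<Rightarrow> real"
  assumes "\<And>x. x \<in> set_pmf p \<Longrightarrow> f x = g x"
  shows "measure_pmf.expectation p f = measure_pmf.expectation p g"
  using assms by (intro integral_cong_AE) (auto simp: AE_measure_pmf_iff)

section \<open>Paths of the controlled process\<close>

definition path_weight :: "('s, 'a) payoff \<Rightarrow> nat \<Rightarrow> nat \<Rightarrow> ('s, 'a) path \<Rightarrow> real" where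
  "path_weight m s t \<omega> =
     exp (\<Sum>k\<in>{s..<t}. running m k (fst \<omega> k) (snd \<omega> k) (fst \<omega> (Suc k)))"

lemma path_weight_cong:
  assumes "\<And>k. k \<le> t \<Longrightarrow> fst \<omega> k = fst \<omega>' k" and "\<And>k. k < t \<Longrightarrow> snd \<omega> k = snd \<omega>' k"
  shows "path_weight m s t \<omega> = path_weight m s t \<omega>'"
  using assms unfolding path_weight_def by (intro arg_cong[where f = exp] sum.cong) auto

lemma path_weight_extend:
  assumes "s \<le> t"
  shows "path_weight m s (Suc t) ((fst \<omega>)(Suc t := y), (snd \<omega>)(t := a)) =
         path_weight m s t \<omega> * exp (running m t (fst \<omega> t) a y)"
proof -
  have "path_weight m s t ((fst \<omega>)(Suc t := y), (snd \<omega>)(t := a)) = path_weight m s t \<omega>"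
    by (rule path_weight_cong) auto
  with assms show ?thesis
    by (simp add: path_weight_def exp_add)
qed

lemma evolve_Suc_kernel:
  "evolve M \<pi> (Suc n) t \<omega> =
     bind_pmf (\<pi> t (fst \<omega> t)) (\<lambda>a. bind_pmf (kernel M t (fst \<omega> t) a)
       (\<lambda>y. evolve M \<pi> n (Suc t) ((fst \<omega>)(Suc t := y), (snd \<omega>)(t := a))))"
  by (simp add: transition_def bind_map_pmf)

lemma evolve_preserves_past:
  assumes "\<omega>' \<in> set_pmf (evolve M \<pi> n t \<omega>)"
  shows "(\<forall>k\<le>t. fst \<omega>' k = fst \<omega> k) \<and> (\<forall>k<t. snd \<omega>' k = snd \<omega> k)"
  using assms
proof (induction n arbitrary: t \<omega>)
  case 0
  then show ?case by simp
next
  case (Suc n)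
  then obtain a y where
    "\<omega>' \<in> set_pmf (evolve M \<pi> n (Suc t) ((fst \<omega>)(Suc t := y), (snd \<omega>)(t := a)))"
    unfolding evolve_Suc_kernel by auto
  from Suc.IH[OF this] show ?case by auto
qed

lemma evolve_add:
  "evolve M \<pi> (n + k) t \<omega> = bind_pmf (evolve M \<pi> n t \<omega>) (evolve M \<pi> k (t + n))"
proof (induction n arbitrary: t \<omega>)
  case 0
  then show ?case by (simp add: bind_return_pmf)
next
  case (Suc n)
  then have "evolve M \<pi> (n + k) (Suc t) =
      (\<lambda>\<omega>. bind_pmf (evolve M \<pi> n (Suc t) \<omega>) (evolve M \<pi> k (t + Suc n)))"
    by auto
  then show ?case by (simp add: bind_assoc_pmf)
qed

lemma evolve_policy_cong:
  assumes "\<And>k. t \<le> k \<Longrightarrow> k < t + n \<Longrightarrow> \<pi> k = \<pi>' k"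
  shows "evolve M \<pi> n t \<omega> = evolve M \<pi>' n t \<omega>"
  using assms
proof (induction n arbitrary: t \<omega>)
  case 0
  then show ?case by simp
next
  case (Suc n)
  have "evolve M \<pi> n (Suc t) = evolve M \<pi>' n (Suc t)"
    using Suc.prems by (intro ext Suc.IH) auto
  moreover have "\<pi> t = \<pi>' t"
    using Suc.prems by simp
  ultimately show ?case by simp
qed

definition prefix_law ::
  "('s, 'a) mdp \<Rightarrow> ('s, 'a) policy \<Rightarrow> 's pmf \<Rightarrow> nat \<Rightarrow> ('s, 'a) path pmf" where
  "prefix_law M \<pi> \<alpha> t = bind_pmf \<alpha> (\<lambda>x. evolve M \<pi> (t - 1) 1 (start_at 1 x))"

lemma process_law_split:
  assumes "1 \<le> t" and "t \<le> horizon M"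
  shows "process_law M \<pi> \<alpha> = bind_pmf (prefix_law M \<pi> \<alpha> t) (evolve M \<pi> (horizon M - t) t)"
proof -
  have "horizon M - 1 = (t - 1) + (horizon M - t)" and "1 + (t - 1) = t"
    using assms by auto
  then show ?thesis
    by (simp only: process_law_def prefix_law_def evolve_add bind_assoc_pmf)
qed

section \<open>The Markov property of the exponential cost\<close>

text \<open>
  The expected weight of the last \<open>n\<close> steps and the terminal payoff, as a function of the state
  in which they start. It is given by its dynamic-programming recursion so that dependence on the
  current state alone is built in.
\<close>

primrec continuation_value ::
  "('s, 'a) mdp \<Rightarrow> ('s, 'a) payoff \<Rightarrow> ('s, 'a) policy \<Rightarrow> nat \<Rightarrow> nat \<Rightarrow> 's \<Rightarrow> real" where
  "continuation_value M m \<pi> 0 t x = exp (terminal m x)"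
| "continuation_value M m \<pi> (Suc n) t x =
     measure_pmf.expectation (\<pi> t x) (\<lambda>a. measure_pmf.expectation (kernel M t x a)
       (\<lambda>y. exp (running m t x a y) * continuation_value M m \<pi> n (Suc t) y))"

lemma continuation_value_policy_cong:
  assumes "\<And>k. t \<le> k \<Longrightarrow> \<pi> k = \<pi>' k"
  shows "continuation_value M m \<pi> n t x = continuation_value M m \<pi>' n t x"
  using assms by (induction n arbitrary: t x) simp_all

context finite_mdp
begin

lemma finite_set_policy:
  assumes "\<pi> \<in> policies M" and "t \<in> {1..<horizon M}" and "x \<in> states M t"
  shows "finite (set_pmf (\<pi> t x))"
  using assms actions_finite[of t x] finite_subset unfolding policies_def by blast

lemma finite_set_kernel:
  assumes "t \<in> {1..<horizon M}" and "x \<in> states M t" and "a \<in> actions M t x"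
  shows "finite (set_pmf (kernel M t x a))"
  using kernel_states[OF assms] states_finite[of "Suc t"] assms(1) finite_subset by fastforce

lemma evolve_support:
  assumes "\<pi> \<in> policies M" and "1 \<le> t" and "t + n \<le> horizon M" and "fst \<omega> t \<in> states M t"
  shows "finite (set_pmf (evolve M \<pi> n t \<omega>)) \<and>
         (\<forall>\<omega>'\<in>set_pmf (evolve M \<pi> n t \<omega>). fst \<omega>' (t + n) \<in> states M (t + n))"
  using assms
proof (induction n arbitrary: t \<omega>)
  case 0
  then show ?case by simp
next
  case (Suc n)
  have t: "t \<in> {1..<horizon M}"
    using Suc.prems by simp
  have act: "a \<in> actions M t (fst \<omega> t)" if "a \<in> set_pmf (\<pi> t (fst \<omega> t))" for a
    using that Suc.prems t unfolding policies_def by blast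
  have step: "finite (set_pmf (evolve M \<pi> n (Suc t) ((fst \<omega>)(Suc t := y), (snd \<omega>)(t := a)))) \<and>
      (\<forall>\<omega>'\<in>set_pmf (evolve M \<pi> n (Suc t) ((fst \<omega>)(Suc t := y), (snd \<omega>)(t := a))).
         fst \<omega>' (Suc t + n) \<in> states M (Suc t + n))"
    if "a \<in> set_pmf (\<pi> t (fst \<omega> t))" and "y \<in> set_pmf (kernel M t (fst \<omega> t) a)" for a y
    using Suc.prems kernel_states[OF t _ act] that by (intro Suc.IH) auto
  show ?case
    unfolding evolve_Suc_kernel set_bind_pmf
    using step finite_set_policy[OF Suc.prems(1) t Suc.prems(4)]
      finite_set_kernel[OF t Suc.prems(4) act]
    by (auto intro!: finite_UN_I)
qed

lemma prefix_law_support: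
  assumes "\<pi> \<in> policies M" and "set_pmf \<alpha> \<subseteq> states M 1" and "t \<in> {1..<horizon M}"
  shows "finite (set_pmf (prefix_law M \<pi> \<alpha> t))"
    and "\<And>\<omega>. \<omega> \<in> set_pmf (prefix_law M \<pi> \<alpha> t) \<Longrightarrow> fst \<omega> t \<in> states M t"
proof -
  have "finite (set_pmf \<alpha>)"
    using assms states_finite[of 1] horizon_ge_2 finite_subset by fastforce
  moreover have "finite (set_pmf (evolve M \<pi> (t - 1) 1 (start_at 1 x))) \<and>
      (\<forall>\<omega>\<in>set_pmf (evolve M \<pi> (t - 1) 1 (start_at 1 x)). fst \<omega> t \<in> states M t)"
    if "x \<in> set_pmf \<alpha>" for x
    using evolve_support[OF assms(1), of 1 "t - 1" "start_at 1 x"] assms that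
    by (auto simp: start_at_def)
  ultimately show "finite (set_pmf (prefix_law M \<pi> \<alpha> t))"
    and "\<And>\<omega>. \<omega> \<in> set_pmf (prefix_law M \<pi> \<alpha> t) \<Longrightarrow> fst \<omega> t \<in> states M t"
    unfolding prefix_law_def by (auto intro!: finite_UN_I)
qed

text \<open>
  The weight is an exponential of a sum, so the part already collected along \<open>\<omega>\<close> factors out and
  what remains depends on \<open>\<omega>\<close> through its current state only. The lower summation limit \<open>s\<close> is
  left free because \<open>J\<close> needs it at \<open>1\<close> and the backward factor at the deviation time.
\<close>

lemma expectation_evolve:
  assumes "\<pi> \<in> policies M" and "1 \<le> t" and "t + n = horizon M" and "fst \<omega> t \<in> states M t"
    and "s \<le> t"
  shows "measure_pmf.expectation (evolve M \<pi> n t \<omega>)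
           (\<lambda>\<omega>'. path_weight m s (horizon M) \<omega>' * exp (terminal m (fst \<omega>' (horizon M)))) =
         path_weight m s t \<omega> * continuation_value M m \<pi> n t (fst \<omega> t)"
  using assms
proof (induction n arbitrary: t \<omega>)
  case 0
  then show ?case by simp
next
  case (Suc n)
  let ?x = "fst \<omega> t"
  let ?G = "\<lambda>\<omega>'. path_weight m s (horizon M) \<omega>' * exp (terminal m (fst \<omega>' (horizon M)))"
  let ?ext = "\<lambda>a y. ((fst \<omega>)(Suc t := y), (snd \<omega>)(t := a))"
  have t: "t \<in> {1..<horizon M}"
    using Suc.prems by simp
  have act: "a \<in> actions M t ?x" if "a \<in> set_pmf (\<pi> t ?x)" for a
    using that Suc.prems t unfolding policies_def by blast
  have next_state: "y \<in> states M (Suc t)"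
    if "a \<in> set_pmf (\<pi> t ?x)" and "y \<in> set_pmf (kernel M t ?x a)" for a y
    using kernel_states[OF t Suc.prems(4) act] that by blast
  have fin_tail: "finite (set_pmf (evolve M \<pi> n (Suc t) (?ext a y)))"
    if "a \<in> set_pmf (\<pi> t ?x)" and "y \<in> set_pmf (kernel M t ?x a)" for a y
    using evolve_support[of \<pi> "Suc t" n "?ext a y"] next_state[OF that] Suc.prems by auto
  note fin_kernel = finite_set_kernel[OF t Suc.prems(4) act]
  have "measure_pmf.expectation (evolve M \<pi> (Suc n) t \<omega>) ?G =
      measure_pmf.expectation (\<pi> t ?x) (\<lambda>a. measure_pmf.expectation
        (bind_pmf (kernel M t ?x a) (\<lambda>y. evolve M \<pi> n (Suc t) (?ext a y))) ?G)"
    unfolding evolve_Suc_kernel using finite_set_policy[OF Suc.prems(1) t Suc.prems(4)]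
    by (rule expectation_bind_finite) (auto intro!: finite_UN_I fin_kernel fin_tail)
  also have "\<dots> = measure_pmf.expectation (\<pi> t ?x) (\<lambda>a. path_weight m s t \<omega> *
      measure_pmf.expectation (kernel M t ?x a)
        (\<lambda>y. exp (running m t ?x a y) * continuation_value M m \<pi> n (Suc t) y))"
  proof (rule expectation_cong_support)
    fix a assume a: "a \<in> set_pmf (\<pi> t ?x)"
    have "measure_pmf.expectation
        (bind_pmf (kernel M t ?x a) (\<lambda>y. evolve M \<pi> n (Suc t) (?ext a y))) ?G =
      measure_pmf.expectation (kernel M t ?x a)
        (\<lambda>y. measure_pmf.expectation (evolve M \<pi> n (Suc t) (?ext a y)) ?G)"
      using fin_kernel[OF a] fin_tail[OF a] by (rule expectation_bind_finite)
    also have "\<dots> = measure_pmf.expectation (kernel M t ?x a)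
        (\<lambda>y. path_weight m s t \<omega> *
           (exp (running m t ?x a y) * continuation_value M m \<pi> n (Suc t) y))"
    proof (rule expectation_cong_support)
      fix y assume "y \<in> set_pmf (kernel M t ?x a)"
      then show "measure_pmf.expectation (evolve M \<pi> n (Suc t) (?ext a y)) ?G =
          path_weight m s t \<omega> *
            (exp (running m t ?x a y) * continuation_value M m \<pi> n (Suc t) y)"
        using Suc.IH[of "Suc t" "?ext a y"] next_state[OF a] Suc.prems
        by (simp add: path_weight_extend mult.assoc)
    qed
    finally show "measure_pmf.expectation
        (bind_pmf (kernel M t ?x a) (\<lambda>y. evolve M \<pi> n (Suc t) (?ext a y))) ?G =
      path_weight m s t \<omega> * measure_pmf.expectation (kernel M t ?x a)
        (\<lambda>y. exp (running m t ?x a y) * continuation_value M m \<pi> n (Suc t) y)"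
      by simp
  qed
  also have "\<dots> = path_weight m s t \<omega> * continuation_value M m \<pi> (Suc n) t ?x"
    by simp
  finally show ?case .
qed

lemma J_eq_prefix_expectation:
  assumes "\<pi> \<in> policies M" and "set_pmf \<alpha> \<subseteq> states M 1" and "t \<in> {1..<horizon M}"
  shows "J M m \<pi> \<alpha> = measure_pmf.expectation (prefix_law M \<pi> \<alpha> t)
           (\<lambda>\<omega>. path_weight m 1 t \<omega> * continuation_value M m \<pi> (horizon M - t) t (fst \<omega> t))"
proof -
  let ?G = "\<lambda>\<omega>. path_weight m 1 (horizon M) \<omega> * exp (terminal m (fst \<omega> (horizon M)))"
  have "J M m \<pi> \<alpha> = measure_pmf.expectation (process_law M \<pi> \<alpha>) ?G"
    by (simp add: J_def path_weight_def case_prod_beta' exp_add)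
  also have "\<dots> = measure_pmf.expectation (prefix_law M \<pi> \<alpha> t)
      (\<lambda>\<omega>. measure_pmf.expectation (evolve M \<pi> (horizon M - t) t \<omega>) ?G)"
    using assms prefix_law_support[OF assms]
    by (subst process_law_split[of t])
      (auto intro!: expectation_bind_finite evolve_support[THEN conjunct1])
  also have "\<dots> = measure_pmf.expectation (prefix_law M \<pi> \<alpha> t)
      (\<lambda>\<omega>. path_weight m 1 t \<omega> * continuation_value M m \<pi> (horizon M - t) t (fst \<omega> t))"
    using assms prefix_law_support(2)[OF assms]
    by (intro expectation_cong_support expectation_evolve) auto
  finally show ?thesis .
qed

text \<open>
  The forward factor is an expectation over the whole horizon, but its integrand looks at
  coordinates up to time \<open>t\<close> only, and those are settled by the prefix.
\<close>

lemma forward_factor_eq_prefix_expectation: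
  assumes "\<pi> \<in> policies M" and "set_pmf \<alpha> \<subseteq> states M 1" and "t \<in> {1..<horizon M}"
  shows "forward_factor M m \<pi> \<alpha> t x = measure_pmf.expectation (prefix_law M \<pi> \<alpha> t)
           (\<lambda>\<omega>. path_weight m 1 t \<omega> * indicat_real {x} (fst \<omega> t))"
proof -
  let ?H = "\<lambda>\<omega>. path_weight m 1 t \<omega> * indicat_real {x} (fst \<omega> t)"
  have "forward_factor M m \<pi> \<alpha> t x = measure_pmf.expectation (process_law M \<pi> \<alpha>) ?H"
    by (simp add: forward_factor_def path_weight_def case_prod_beta')
  also have "\<dots> = measure_pmf.expectation (prefix_law M \<pi> \<alpha> t)
      (\<lambda>\<omega>. measure_pmf.expectation (evolve M \<pi> (horizon M - t) t \<omega>) ?H)"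
    using assms prefix_law_support[OF assms]
    by (subst process_law_split[of t])
      (auto intro!: expectation_bind_finite evolve_support[THEN conjunct1])
  also have "\<dots> = measure_pmf.expectation (prefix_law M \<pi> \<alpha> t) ?H"
  proof (rule expectation_cong_support)
    fix \<omega>
    have "measure_pmf.expectation (evolve M \<pi> (horizon M - t) t \<omega>) ?H =
        measure_pmf.expectation (evolve M \<pi> (horizon M - t) t \<omega>) (\<lambda>_. ?H \<omega>)"
    proof (rule expectation_cong_support)
      fix \<omega>' assume "\<omega>' \<in> set_pmf (evolve M \<pi> (horizon M - t) t \<omega>)"
      then have "(\<forall>k\<le>t. fst \<omega>' k = fst \<omega> k) \<and> (\<forall>k<t. snd \<omega>' k = snd \<omega> k)"
        by (rule evolve_preserves_past)
      then show "?H \<omega>' = ?H \<omega>"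
        using path_weight_cong[of t \<omega>' \<omega>] by simp
    qed
    then show "measure_pmf.expectation (evolve M \<pi> (horizon M - t) t \<omega>) ?H = ?H \<omega>"
      by simp
  qed
  finally show ?thesis .
qed

lemma backward_factor_eq_continuation_value:
  assumes "\<pi> \<in> policies M" and "t \<in> {1..<horizon M}" and "x \<in> states M t"
    and "a \<in> actions M t x"
  shows "backward_factor M m \<pi> t x a = measure_pmf.expectation (kernel M t x a)
           (\<lambda>y. exp (running m t x a y) *
              continuation_value M m \<pi> (horizon M - Suc t) (Suc t) y)"
proof -
  let ?G = "\<lambda>\<omega>. path_weight m t (horizon M) \<omega> * exp (terminal m (fst \<omega> (horizon M)))"
  let ?\<omega> = "\<lambda>y. ((fst (start_at t x :: ('s, 'a) path))(Suc t := y), (snd (start_at t x))(t := a))"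
  have next_state: "y \<in> states M (Suc t)" if "y \<in> set_pmf (kernel M t x a)" for y
    using kernel_states[OF assms(2-4)] that by blast
  have "backward_factor M m \<pi> t x a = measure_pmf.expectation
      (bind_pmf (kernel M t x a) (\<lambda>y. evolve M \<pi> (horizon M - Suc t) (Suc t) (?\<omega> y))) ?G"
    by (simp add: backward_factor_def process_law_from_def transition_def bind_map_pmf
        path_weight_def case_prod_beta' exp_add start_at_def)
  also have "\<dots> = measure_pmf.expectation (kernel M t x a) (\<lambda>y.
      measure_pmf.expectation (evolve M \<pi> (horizon M - Suc t) (Suc t) (?\<omega> y)) ?G)"
    using assms next_state
    by (intro expectation_bind_finite finite_set_kernel evolve_support[THEN conjunct1]) auto
  also have "\<dots> = measure_pmf.expectation (kernel M t x a) (\<lambda>y. exp (running m t x a y) *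
      continuation_value M m \<pi> (horizon M - Suc t) (Suc t) y)"
  proof (rule expectation_cong_support)
    fix y assume "y \<in> set_pmf (kernel M t x a)"
    then have "measure_pmf.expectation (evolve M \<pi> (horizon M - Suc t) (Suc t) (?\<omega> y)) ?G =
        path_weight m t (Suc t) (?\<omega> y) *
          continuation_value M m \<pi> (horizon M - Suc t) (Suc t) (fst (?\<omega> y) (Suc t))"
      using assms next_state by (intro expectation_evolve) auto
    then show "measure_pmf.expectation (evolve M \<pi> (horizon M - Suc t) (Suc t) (?\<omega> y)) ?G =
        exp (running m t x a y) * continuation_value M m \<pi> (horizon M - Suc t) (Suc t) y"
      by (simp add: path_weight_def start_at_def)
  qed
  finally show ?thesis .
qed

section \<open>One-stage deviations\<close>

lemma deviation_in_policies:
  assumes "\<pi> \<in> policies M" and "\<pi>' \<in> policies M"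
  shows "\<pi>(t := \<pi>' t) \<in> policies M"
  using assms unfolding policies_def by auto

text \<open>
  Since \<open>\<pi>(t := \<pi>' t)\<close> uses \<open>\<pi>\<close> after time \<open>t\<close>, its continuation value at \<open>t\<close> averages the backward
  factors of \<open>\<pi>\<close> with the weights of \<open>\<pi>'\<close>.
\<close>

lemma continuation_value_deviation:
  assumes "\<pi> \<in> policies M" and "\<pi>' \<in> policies M" and "t \<in> {1..<horizon M}"
    and "x \<in> states M t"
  shows "continuation_value M m (\<pi>(t := \<pi>' t)) (horizon M - t) t x =
         (\<Sum>a\<in>actions M t x. pmf (\<pi>' t x) a * backward_factor M m \<pi> t x a)"
proof -
  have supp: "set_pmf (\<pi>' t x) \<subseteq> actions M t x"
    using assms unfolding policies_def by blast
  have "horizon M - t = Suc (horizon M - Suc t)"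
    using assms by auto
  moreover have "continuation_value M m (\<pi>(t := \<pi>' t)) (horizon M - Suc t) (Suc t) =
      continuation_value M m \<pi> (horizon M - Suc t) (Suc t)"
    by (intro ext continuation_value_policy_cong) auto
  ultimately have "continuation_value M m (\<pi>(t := \<pi>' t)) (horizon M - t) t x =
      measure_pmf.expectation (\<pi>' t x) (\<lambda>a. measure_pmf.expectation (kernel M t x a)
        (\<lambda>y. exp (running m t x a y) *
           continuation_value M m \<pi> (horizon M - Suc t) (Suc t) y))"
    by simp
  also have "\<dots> = measure_pmf.expectation (\<pi>' t x) (backward_factor M m \<pi> t x)"
    using assms supp
    by (intro expectation_cong_support) (auto simp: backward_factor_eq_continuation_value)
  also have "\<dots> = (\<Sum>a\<in>actions M t x. pmf (\<pi>' t x) a * backward_factor M m \<pi> t x a)"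
    using assms supp actions_finite
    by (subst integral_measure_pmf_real[of "actions M t x"]) (auto simp: mult.commute)
  finally show ?thesis .
qed

text \<open>
  Although \<open>J\<close> is nonlinear in the policy as a whole, it is affine in each decision rule with the
  others fixed. Partitioning according to \<open>X\<^sub>t\<close> exhibits this: the weight before time \<open>t\<close> is
  unaffected by the deviation, and the continuation value is affine in the rule used at \<open>t\<close>.
\<close>

lemma stage_value_eq_J:
  assumes "\<pi> \<in> policies M" and "\<pi>' \<in> policies M" and "set_pmf \<alpha> \<subseteq> states M 1"
    and t: "t \<in> {1..<horizon M}"
  shows "stage_value M t \<pi>' (forward_factor M m \<pi> \<alpha>) (backward_factor M m \<pi>) =
         J M m (\<pi>(t := \<pi>' t)) \<alpha>"
proof -
  let ?dev = "\<pi>(t := \<pi>' t)"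
  let ?P = "prefix_law M \<pi> \<alpha> t"
  let ?V = "continuation_value M m ?dev (horizon M - t) t"
  note supp = prefix_law_support[OF assms(1,3,4)]
  have "evolve M ?dev (t - 1) 1 = evolve M \<pi> (t - 1) 1"
    using t by (intro ext evolve_policy_cong) auto
  then have prefix: "prefix_law M ?dev \<alpha> t = ?P"
    by (simp add: prefix_law_def)
  have int: "integrable (measure_pmf ?P) f" for f :: "('s, 'a) path \<Rightarrow> real"
    using supp(1) by (rule integrable_measure_pmf_finite)
  have "J M m ?dev \<alpha> =
      measure_pmf.expectation ?P (\<lambda>\<omega>. path_weight m 1 t \<omega> * ?V (fst \<omega> t))"
    using J_eq_prefix_expectation[OF deviation_in_policies[OF assms(1,2)] assms(3) t]
    by (simp only: prefix)
  also have "\<dots> = measure_pmf.expectation ?P (\<lambda>\<omega>.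
      \<Sum>x\<in>states M t. path_weight m 1 t \<omega> * indicat_real {x} (fst \<omega> t) * ?V x)"
  proof (rule expectation_cong_support)
    fix \<omega> assume "\<omega> \<in> set_pmf ?P"
    then have "fst \<omega> t \<in> states M t"
      by (rule supp(2))
    moreover have "path_weight m 1 t \<omega> * indicat_real {x} (fst \<omega> t) * ?V x =
        (if x = fst \<omega> t then path_weight m 1 t \<omega> * ?V x else 0)" for x
      by auto
    ultimately show "path_weight m 1 t \<omega> * ?V (fst \<omega> t) =
        (\<Sum>x\<in>states M t. path_weight m 1 t \<omega> * indicat_real {x} (fst \<omega> t) * ?V x)"
      using states_finite[of t] t by simp
  qed
  also have "\<dots> = (\<Sum>x\<in>states M t. forward_factor M m \<pi> \<alpha> t x * ?V x)"
    using assms int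
    by (simp add: Bochner_Integration.integral_sum forward_factor_eq_prefix_expectation)
  also have "\<dots> = (\<Sum>x\<in>states M t. \<Sum>a\<in>actions M t x.
      forward_factor M m \<pi> \<alpha> t x * pmf (\<pi>' t x) a * backward_factor M m \<pi> t x a)"
    using assms
    by (intro sum.cong) (simp_all add: continuation_value_deviation sum_distrib_left mult.assoc)
  finally show ?thesis
    by (simp add: stage_value_def)
qed

end

section \<open>Optimal policies are fixed points\<close>

theorem theorem1:
  fixes M :: "('s, 'a) mdp"
    and r_tilde c_tilde r c :: "('s, 'a) payoff"
    and \<gamma> \<gamma>\<^sub>c \<beta> \<beta>\<^sub>c B :: real
    and \<alpha>\<^sub>r \<alpha>\<^sub>c :: "'s pmf"
    and \<pi>_star :: "('s, 'a) policy"
  assumes "finite_mdp M"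
    and "\<beta> \<in> {0<..<1}" and "\<beta>\<^sub>c \<in> {0<..<1}"
    and "r = risk_discounted M \<gamma> \<beta> r_tilde"
    and "c = risk_discounted M \<gamma>\<^sub>c \<beta>\<^sub>c c_tilde"
    and "set_pmf \<alpha>\<^sub>r \<subseteq> states M 1" and "set_pmf \<alpha>\<^sub>c \<subseteq> states M 1"
    and "risk_constrained_solutions M r c \<alpha>\<^sub>r \<alpha>\<^sub>c B \<noteq> {}"
    and "\<pi>_star \<in> risk_constrained_solutions M r c \<alpha>\<^sub>r \<alpha>\<^sub>c B"
  shows "\<pi>_star \<in> LP_solutions M r c \<alpha>\<^sub>r \<alpha>\<^sub>c B \<pi>_star"
proof -
  interpret finite_mdp M by fact
  let ?obj = "\<lambda>\<pi>'. \<Sum>t\<in>{1..<horizon M}. stage_value M t \<pi>'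
      (forward_factor M r \<pi>_star \<alpha>\<^sub>r) (backward_factor M r \<pi>_star)"
  let ?cost = "\<lambda>t \<pi>'. stage_value M t \<pi>'
      (forward_factor M c \<pi>_star \<alpha>\<^sub>c) (backward_factor M c \<pi>_star)"
  have star: "\<pi>_star \<in> policies M" and star_feasible: "J M c \<pi>_star \<alpha>\<^sub>c \<le> B"
    and star_optimal:
      "\<And>\<pi>'. \<pi>' \<in> policies M \<Longrightarrow> J M c \<pi>' \<alpha>\<^sub>c \<le> B \<Longrightarrow> J M r \<pi>' \<alpha>\<^sub>r \<le> J M r \<pi>_star \<alpha>\<^sub>r"
    using assms(9) by (auto simp: risk_constrained_solutions_def is_arg_max_linorder)
  have feasible: "?cost t \<pi>_star \<le> B" if "t \<in> {1..<horizon M}" for t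
    using stage_value_eq_J[OF star star assms(7) that] star_feasible by simp
  have "?obj \<pi>' \<le> ?obj \<pi>_star"
    if pol: "\<pi>' \<in> policies M" and lp: "\<forall>t\<in>{1..<horizon M}. ?cost t \<pi>' \<le> B" for \<pi>'
  proof (rule sum_mono)
    fix t assume t: "t \<in> {1..<horizon M}"
    have "J M c (\<pi>_star(t := \<pi>' t)) \<alpha>\<^sub>c \<le> B"
      using bspec[OF lp t] by (simp only: stage_value_eq_J[OF star pol assms(7) t])
    then have "J M r (\<pi>_star(t := \<pi>' t)) \<alpha>\<^sub>r \<le> J M r \<pi>_star \<alpha>\<^sub>r"
      by (rule star_optimal[OF deviation_in_policies[OF star pol]])
    then show "stage_value M t \<pi>' (forward_factor M r \<pi>_star \<alpha>\<^sub>r) (backward_factor M r \<pi>_star) \<le>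
        stage_value M t \<pi>_star (forward_factor M r \<pi>_star \<alpha>\<^sub>r) (backward_factor M r \<pi>_star)"
      using stage_value_eq_J[OF star pol assms(6) t] stage_value_eq_J[OF star star assms(6) t]
      by simp
  qed
  with star feasible show ?thesis
    by (auto simp: LP_solutions_def is_arg_max_linorder)
qed

end
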